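(* Let $\Gamma:\ell_\infty^+\to\ell_\infty^+$ be a gain operator and $\hat\Gamma(s)=s\oplus\Gamma(s)$. Assume that the system $s(k+1)=\hat\Gamma(s(k))$ is UGS, i.e. there exists $\varphi\in\mathcal{K}_\infty$ such that $$\|\hat\Gamma^k(s)\|_\infty\le\varphi(\|s\|_\infty)\quad\text{for all }s\in\ell_\infty^+,\ k\in\mathbb{Z}_+.$$ Then, for each $s\in\ell_\infty^+$, there is $s^*\in\ell_\infty^+$ such that $\Gamma(s^* )\le s^*$ and $s\le s^*\le\varphi(\|s\|_\infty)\mathbb{1}$.
   Context: $\mathbb{N}=\{1,2,\dots\}$, $\mathbb{Z}_+=\{0,1,\dots\}$, $\mathbb{R}_+=[0,\infty)$. $\ell_\infty$ is the Banach space of bounded real sequences with sup norm $\|\cdot\|_\infty$; $\ell_\infty^+$ is the cone of nonnegative sequences; $\le$ is the componentwise order; $\oplus$ is the componentwise maximum; $\mathbb{1}$ is the sequence with all components $1$. For $I\subseteq\mathbb{N}$, $\ell_\infty^+(I)=\{s\in\ell_\infty^+: s_i=0\ \forall i\notin I\}$. $\mathcal{K}$: continuous strictly increasing $\gamma:\mathbb{R}_+\to\mathbb{R}_+$ with $\gamma(0)=0$; $\mathcal{K}_\infty$: unbounded elements of $\mathcal{K}$. A monotone aggregation function (MAF) is $\mu:\ell_\infty^+\to[0,\infty]$ with $\mu(0)=0$; $s^1\le s^2\Rightarrow\mu(s^1)\le\mu(s^2)$; and $\mu$ finite-valued and continuous on $\ell_\infty^+(I)$ for every finite $I\subset\mathbb{N}$.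 Gain operator: for each $i\in\mathbb{N}$ one is given a finite set $I_i\subset\mathbb{N}\setminus\{i\}$, functions $\gamma_{ij}\in\mathcal{K}\cup\{0\}$ ($j\in\mathbb{N}$) with $\gamma_{ij}=0$ for $j\notin I_i$, and a MAF $\mu_i$; $\Gamma(s)=(\mu_i([\gamma_{ij}(s_j)]_{j\in\mathbb{N}}))_{i\in\mathbb{N}}$. Standing assumption: $\Gamma$ is well-defined (maps $\ell_\infty^+$ into itself) and norm-continuous. *)

theory Defs
  imports "HOL-Analysis.Analysis"
begin

text \<open>
  The index set of the sequences is the type \<^typ>\<open>nat\<close>, so the indices
  \<open>1, 2, \<dots>\<close> are renumbered as \<open>0, 1, \<dots>\<close>. As \<^typ>\<open>nat\<close> is discrete, the Banach space of
  bounded continuous functions on it is the space of all bounded real sequences with the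
  supremum norm.
\<close>

type_synonym linf = "nat \<Rightarrow>\<^sub>C real"

lemma bounded_seq_bcontfun:
  fixes f :: "nat \<Rightarrow> real"
  shows "f \<in> bcontfun \<longleftrightarrow> bounded (range f)"
  by (simp add: bcontfun_def continuous_on_discrete)

definition linf_le :: "linf \<Rightarrow> linf \<Rightarrow> bool"  (infix \<open>\<preceq>\<close> 50)
  where "s \<preceq> t \<longleftrightarrow> (\<forall>i. apply_bcontfun s i \<le> apply_bcontfun t i)"

definition linf_max :: "linf \<Rightarrow> linf \<Rightarrow> linf"  (infixl \<open>\<oplus>\<^sub>m\<close> 65)
  where "s \<oplus>\<^sub>m t = Bcontfun (\<lambda>i. max (apply_bcontfun s i) (apply_bcontfun t i))"

lemma apply_linf_max:
  "apply_bcontfun (s \<oplus>\<^sub>m t) i = max (apply_bcontfun s i) (apply_bcontfun t i)"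
proof -
  have "\<bar>max (apply_bcontfun s j) (apply_bcontfun t j)\<bar> \<le> norm s + norm t" for j
    using norm_bounded[of s j] norm_bounded[of t j] norm_ge_zero[of s] norm_ge_zero[of t]
    unfolding real_norm_def by linarith
  then have "(\<lambda>j. max (apply_bcontfun s j) (apply_bcontfun t j)) \<in> bcontfun"
    by (auto simp: bounded_seq_bcontfun bounded_iff)
  then show ?thesis
    by (simp add: linf_max_def Bcontfun_inverse)
qed

definition linf_pos :: "linf set"
  where "linf_pos = {s. 0 \<preceq> s}"

definition linf_pos_on :: "nat set \<Rightarrow> linf set"
  where "linf_pos_on I = {s \<in> linf_pos. \<forall>i. i \<notin> I \<longrightarrow> apply_bcontfun s i = 0}"

text \<open>
  Functions from the nonnegative reals to themselves are represented by functions of type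
  \<^typ>\<open>real \<Rightarrow> real\<close> of which only the values on \<^term>\<open>{0::real..}\<close> matter. Nonnegativity of
  the values follows from strict monotonicity and the value at \<open>0\<close>.
\<close>

definition class_K :: "(real \<Rightarrow> real) set"
  where "class_K = {\<gamma>. continuous_on {0..} \<gamma> \<and> strict_mono_on {0..} \<gamma> \<and> \<gamma> 0 = 0}"

definition class_K_inf :: "(real \<Rightarrow> real) set"
  where "class_K_inf = {\<gamma> \<in> class_K. \<not> bounded (\<gamma> ` {0..})}"

definition zero_gain :: "(real \<Rightarrow> real) \<Rightarrow> bool"
  where "zero_gain \<gamma> \<longleftrightarrow> (\<forall>r\<ge>0. \<gamma> r = 0)"

definition MAF :: "(linf \<Rightarrow> ennreal) \<Rightarrow> bool"
  where "MAF \<mu> \<longleftrightarrow>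
    \<mu> 0 = 0 \<and>
    (\<forall>s\<in>linf_pos. \<forall>t\<in>linf_pos. s \<preceq> t \<longrightarrow> \<mu> s \<le> \<mu> t) \<and>
    (\<forall>I. finite I \<longrightarrow> (\<forall>s\<in>linf_pos_on I. \<mu> s < \<infinity>) \<and> continuous_on (linf_pos_on I) \<mu>)"

definition gain_family ::
    "(nat \<Rightarrow> nat set) \<Rightarrow> (nat \<Rightarrow> nat \<Rightarrow> real \<Rightarrow> real) \<Rightarrow> (nat \<Rightarrow> linf \<Rightarrow> ennreal) \<Rightarrow> bool"
  where "gain_family I \<gamma> \<mu> \<longleftrightarrow>
    (\<forall>i. finite (I i) \<and> i \<notin> I i) \<and>
    (\<forall>i j. \<gamma> i j \<in> class_K \<or> zero_gain (\<gamma> i j)) \<and>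
    (\<forall>i j. j \<notin> I i \<longrightarrow> zero_gain (\<gamma> i j)) \<and>
    (\<forall>i. MAF (\<mu> i))"

text \<open>
  The \<open>i\<close>-th row of weighted components. It has finite support for a gain family, so it is
  bounded and \<^const>\<open>Bcontfun\<close> does not yield a junk value (see the lemma below).
\<close>

definition gain_row :: "(nat \<Rightarrow> nat \<Rightarrow> real \<Rightarrow> real) \<Rightarrow> nat \<Rightarrow> linf \<Rightarrow> linf"
  where "gain_row \<gamma> i s = Bcontfun (\<lambda>j. \<gamma> i j (apply_bcontfun s j))"

lemma apply_gain_row:
  assumes "gain_family I \<gamma> \<mu>" and "s \<in> linf_pos"
  shows "apply_bcontfun (gain_row \<gamma> i s) j = \<gamma> i j (apply_bcontfun s j)"
proof -
  let ?f = "\<lambda>j. \<gamma> i j (apply_bcontfun s j)"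
  have "?f j = 0" if "j \<notin> I i" for j
    using assms that
    by (simp add: gain_family_def zero_gain_def linf_pos_def linf_le_def)
  then have "range ?f \<subseteq> insert 0 (?f ` I i)"
    by auto
  moreover have "finite (I i)"
    using assms(1) by (simp add: gain_family_def)
  ultimately have "finite (range ?f)"
    by (meson finite_imageI finite_insert finite_subset)
  then have "?f \<in> bcontfun"
    by (simp add: bounded_seq_bcontfun finite_imp_bounded)
  then show ?thesis
    by (simp add: gain_row_def Bcontfun_inverse)
qed

text \<open>
  Requiring the components of the bounded nonnegative sequence \<open>\<Gamma> s\<close> to be the values of the
  aggregation functions expresses that the gain operator is well defined. Only the values of
  \<open>\<Gamma>\<close> on the positive cone matter.
\<close>

definition gain_operator :: "(linf \<Rightarrow> linf) \<Rightarrow> bool"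
  where "gain_operator \<Gamma> \<longleftrightarrow>
    (\<exists>I \<gamma> \<mu>. gain_family I \<gamma> \<mu> \<and>
      (\<forall>s\<in>linf_pos. \<Gamma> s \<in> linf_pos \<and>
        (\<forall>i. ennreal (apply_bcontfun (\<Gamma> s) i) = \<mu> i (gain_row \<gamma> i s)))) \<and>
    continuous_on linf_pos \<Gamma>"

definition aug :: "(linf \<Rightarrow> linf) \<Rightarrow> linf \<Rightarrow> linf"
  where "aug \<Gamma> s = s \<oplus>\<^sub>m \<Gamma> s"

end

(* The orbit s(k) is nondecreasing and bounded by \<phi> (norm s), so it converges componentwise to
   its supremum s*, although in general not in norm. Each component of \<Gamma> depends on finitely many
   coordinates only, hence is continuous along the orbit also for componentwise convergence, and
   \<Gamma> (s k) \<le> s (k+1) \<le> s* passes to the limit. *)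
theory Submission
  imports Defs
begin

lemma linf_pos_iff: "s \<in> linf_pos \<longleftrightarrow> (\<forall>i. 0 \<le> apply_bcontfun s i)"
  by (simp add: linf_pos_def linf_le_def)

text \<open>The sup distance is at most the sum of the coordinate distances over \<open>I\<close>,
  since all other coordinates agree. A finite sum of null sequences is null, so convergence of each
  coordinate is enough for norm convergence.\<close>

lemma tendsto_linf_finite_support:
  fixes x :: "nat \<Rightarrow> linf"
  assumes "finite I"
    and supp: "\<And>n i. i \<notin> I \<Longrightarrow> apply_bcontfun (x n) i = apply_bcontfun y i"
    and lim: "\<And>i. (\<lambda>n. apply_bcontfun (x n) i) \<longlonglongrightarrow> apply_bcontfun y i"
  shows "x \<longlonglongrightarrow> y"
proof -
  let ?d = "\<lambda>n i. dist (apply_bcontfun (x n) i) (apply_bcontfun y i)"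
  have "(\<lambda>n. \<Sum>i\<in>I. ?d n i) \<longlonglongrightarrow> (\<Sum>i\<in>I. 0)"
    by (intro tendsto_sum lim[THEN tendsto_dist_iff[THEN iffD1]])
  moreover have "dist (x n) y \<le> (\<Sum>i\<in>I. ?d n i)" for n
  proof (rule dist_bound)
    fix i
    show "?d n i \<le> (\<Sum>i\<in>I. ?d n i)"
    proof (cases "i \<in> I")
      case True
      then show ?thesis
        using member_le_sum[of i I "?d n"] \<open>finite I\<close> by simp
    next
      case False
      then show ?thesis
        by (simp add: supp sum_nonneg)
    qed
  qed
  ultimately have "(\<lambda>n. dist (x n) y) \<longlonglongrightarrow> 0"
    by (intro tendsto_sandwich[of "\<lambda>_. 0" "\<lambda>n. dist (x n) y" sequentially]) auto
  then show ?thesis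
    by (rule tendsto_dist_iff[THEN iffD2])
qed

lemma gain_operator_pos: "gain_operator \<Gamma> \<Longrightarrow> s \<in> linf_pos \<Longrightarrow> \<Gamma> s \<in> linf_pos"
  by (auto simp: gain_operator_def)

text \<open>Component \<open>i\<close> reads its argument only through the coordinates in the finite
  set \<open>I i\<close>. The rows therefore stay in \<open>linf_pos_on (I i)\<close>, where
  componentwise convergence is norm convergence and \<open>\<mu> i\<close> is continuous.\<close>

lemma gain_operator_componentwise_continuous:
  assumes "gain_operator \<Gamma>"
    and x: "\<And>n. x n \<in> linf_pos" and y: "y \<in> linf_pos"
    and lim: "\<And>i. (\<lambda>n. apply_bcontfun (x n) i) \<longlonglongrightarrow> apply_bcontfun y i"
  shows "(\<lambda>n. apply_bcontfun (\<Gamma> (x n)) i) \<longlonglongrightarrow> apply_bcontfun (\<Gamma> y) i"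
proof -
  obtain I \<gamma> \<mu> where fam: "gain_family I \<gamma> \<mu>"
    and \<Gamma>: "\<And>s i. s \<in> linf_pos \<Longrightarrow>
      ennreal (apply_bcontfun (\<Gamma> s) i) = \<mu> i (gain_row \<gamma> i s)"
    using assms(1) unfolding gain_operator_def by blast
  have fin: "finite (I i)"
    and zero: "\<And>j. j \<notin> I i \<Longrightarrow> zero_gain (\<gamma> i j)"
    and gain: "\<And>j. \<gamma> i j \<in> class_K \<or> zero_gain (\<gamma> i j)"
    and maf: "MAF (\<mu> i)"
    using fam by (auto simp: gain_family_def)
  note row = apply_gain_row[OF fam]
  \<comment> \<open>The rows must lie in the positive cone, because continuity of
    \<open>\<mu> i\<close> is available only there.\<close>
  have nonneg: "0 \<le> \<gamma> i j r" if "0 \<le> r" for j r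
    using gain[of j]
  proof
    assume "\<gamma> i j \<in> class_K"
    then have "mono_on {0..} (\<gamma> i j)" "\<gamma> i j 0 = 0"
      by (auto simp: class_K_def strict_mono_on_imp_mono_on)
    then show ?thesis
      using that mono_onD[of "{0..}" "\<gamma> i j" 0 r] by simp
  qed (use that in \<open>simp add: zero_gain_def\<close>)
  \<comment> \<open>A zero gain is prescribed only on \<open>{0..}\<close>, so it is compared there
    with the constant function 0.\<close>
  have cont: "continuous_on {0..} (\<gamma> i j)" for j
    using gain[of j]
  proof
    assume "zero_gain (\<gamma> i j)"
    then show ?thesis
      by (subst continuous_on_cong[OF refl, of _ _ "\<lambda>_. 0"]) (auto simp: zero_gain_def)
  qed (simp add: class_K_def)
  have supp: "apply_bcontfun (gain_row \<gamma> i s) j = 0" if "s \<in> linf_pos" "j \<notin> I i" for s j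
    using that zero[of j] by (simp add: row zero_gain_def linf_pos_iff)
  have mem: "gain_row \<gamma> i s \<in> linf_pos_on (I i)" if "s \<in> linf_pos" for s
    using that nonneg supp by (simp add: linf_pos_on_def linf_pos_iff row)
  have "(\<lambda>n. gain_row \<gamma> i (x n)) \<longlonglongrightarrow> gain_row \<gamma> i y"
  proof (rule tendsto_linf_finite_support[OF fin])
    show "(\<lambda>n. apply_bcontfun (gain_row \<gamma> i (x n)) j) \<longlonglongrightarrow> apply_bcontfun (gain_row \<gamma> i y) j"
      for j
      using continuous_on_tendsto_compose[OF cont lim] x y by (simp add: row linf_pos_iff)
  qed (simp add: supp x y)
  moreover have cont_mu: "continuous_on (linf_pos_on (I i)) (\<mu> i)"
    using maf fin by (simp add: MAF_def)
  ultimately have "(\<lambda>n. \<mu> i (gain_row \<gamma> i (x n))) \<longlonglongrightarrow> \<mu> i (gain_row \<gamma> i y)"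
    by (intro continuous_on_tendsto_compose[OF cont_mu]) (simp_all add: mem x y)
  then have "(\<lambda>n. ennreal (apply_bcontfun (\<Gamma> (x n)) i)) \<longlonglongrightarrow> ennreal (apply_bcontfun (\<Gamma> y) i)"
    by (simp add: \<Gamma> x y)
  \<comment> \<open>The limit transfers from \<open>ennreal\<close> back to the reals because all
    values are nonnegative; on negative numbers \<open>ennreal\<close> would truncate to 0.\<close>
  then show ?thesis
    using gain_operator_pos[OF assms(1)] x y by (simp add: linf_pos_iff)
qed

theorem proposition3p5:
  fixes \<Gamma> :: "linf \<Rightarrow> linf" and \<phi> :: "real \<Rightarrow> real"
  assumes "gain_operator \<Gamma>"
    and "\<phi> \<in> class_K_inf"
    and "\<forall>s\<in>linf_pos. \<forall>k::nat. norm ((aug \<Gamma> ^^ k) s) \<le> \<phi> (norm s)"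
  shows "\<forall>s\<in>linf_pos. \<exists>s'\<in>linf_pos.
    \<Gamma> s' \<preceq> s' \<and> s \<preceq> s' \<and> s' \<preceq> \<phi> (norm s) *\<^sub>R const_bcontfun 1"
proof
  fix s assume s: "s \<in> linf_pos"
  define x where "x k = (aug \<Gamma> ^^ k) s" for k
  define B where "B = \<phi> (norm s)"
  have x_0: "x 0 = s"
    by (simp add: x_def)
  have x_Suc: "apply_bcontfun (x (Suc k)) i =
      max (apply_bcontfun (x k) i) (apply_bcontfun (\<Gamma> (x k)) i)" for k i
    by (simp add: x_def aug_def apply_linf_max)
  \<comment> \<open>Taking the maximum with the current state makes the orbit nondecreasing by
    construction.\<close>
  have inc: "incseq (\<lambda>k. apply_bcontfun (x k) i)" for i
    by (simp add: incseq_SucI x_Suc)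
  then have s_le: "apply_bcontfun s i \<le> apply_bcontfun (x k) i" for i k
    using incseqD[of "\<lambda>k. apply_bcontfun (x k) i" 0 k] by (simp add: x_0)
  then have x_pos: "x k \<in> linf_pos" for k
    unfolding linf_pos_iff using s[unfolded linf_pos_iff] by (blast intro: order_trans)
  have x_le: "apply_bcontfun (x k) i \<le> B" for k i
  proof -
    have "norm (x k) \<le> B"
      using assms(3) s by (simp add: x_def B_def)
    then show ?thesis
      using norm_bounded[of "x k" i] by simp
  qed
  define L where "L i = (SUP k. apply_bcontfun (x k) i)" for i
  have lim: "(\<lambda>k. apply_bcontfun (x k) i) \<longlonglongrightarrow> L i" for i
    unfolding L_def using x_le inc by (intro LIMSEQ_incseq_SUP bdd_aboveI2)
  have le_L: "apply_bcontfun (x k) i \<le> L i" for k i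
    using incseq_le[OF inc lim] .
  have L_le: "L i \<le> B" for i
    using LIMSEQ_le_const2[OF lim] x_le by blast
  have L_nonneg: "0 \<le> L i" for i
    using le_L[of 0 i] x_pos[of 0] order_trans by (auto simp: linf_pos_iff)
  \<comment> \<open>The componentwise limit takes values in \<open>{0..B}\<close>, hence is a
    bounded sequence and defines a genuine element \<open>y\<close> of \<open>linf\<close>.\<close>
  have "L \<in> bcontfun"
    unfolding bounded_seq_bcontfun bounded_iff using L_le L_nonneg by (auto intro!: exI[of _ B])
  then obtain y where y: "\<And>i. apply_bcontfun y i = L i"
    using Bcontfun_inverse[of L] by metis
  have y_pos: "y \<in> linf_pos"
    by (simp add: linf_pos_iff y L_nonneg)
  \<comment> \<open>The index shifts by one: \<open>\<Gamma> (x k)\<close> lies below the next orbit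
    point, which lies below the limit.\<close>
  have "apply_bcontfun (\<Gamma> (x k)) i \<le> apply_bcontfun y i" for k i
    using le_L[of "Suc k" i] by (simp add: x_Suc y)
  moreover have "(\<lambda>k. apply_bcontfun (\<Gamma> (x k)) i) \<longlonglongrightarrow> apply_bcontfun (\<Gamma> y) i" for i
    by (rule gain_operator_componentwise_continuous[OF assms(1) x_pos y_pos]) (simp add: y lim)
  ultimately have "\<Gamma> y \<preceq> y"
    unfolding linf_le_def by (meson LIMSEQ_le_const2)
  moreover have "s \<preceq> y"
    using le_L[of 0] by (simp add: linf_le_def y x_0)
  moreover have "y \<preceq> \<phi> (norm s) *\<^sub>R const_bcontfun 1"
    using L_le by (simp add: linf_le_def y B_def)
  ultimately show "\<exists>s'\<in>linf_pos. \<Gamma> s' \<preceq> s' \<and> s \<preceq> s' \<and> s' \<preceq> \<phi> (norm s) *\<^sub>R const_bcontfun 1"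
    using y_pos by blast
qed

end
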